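(* Let $R$ be an integral domain, $n=2$, and let $f\in R[x_1,x_2]$ satisfy $\deg_{x_i}f>0$ for $i=1,2$ and $\deg_{\mathbf{w}(f)}f=(\deg_{x_1}f)(\deg_{x_2}f)$. If $f$ is tamely reduced over $R$, then: (i) if $\deg_{x_1}f=\deg_{x_2}f$, then $H(f)\subseteq\mathrm{Aff}(R,\mathbf{x})$; (ii) if $\deg_{x_i}f>\deg_{x_j}f$ for $i,j\in\{1,2\}$, $i\ne j$, then $H(f)\subseteq J(R;x_i,x_j)$.
   Context: $\mathrm{Aff}(R,\mathbf{x})$, $\mathrm{T}(R,\mathbf{x})$: subgroups of $\mathrm{Aut}(R[x_1,x_2]/R)$ generated by affine automorphisms ($\deg\phi(x_i)=1$ for all $i$), resp. by affine and elementary automorphisms (elementary: fixing all variables but one). $\mathbf{w}(f)=(\deg_{x_2}f,\deg_{x_1}f)\in\mathbb{Z}^2$, and $\deg_{\mathbf{w}}$ is the weighted degree giving $x_1,x_2$ weights $w_1,w_2$. $f\in R[\mathbf{x}]\setminus R$ is tamely reduced over $R$ if $\deg_{x_1}\tau(f)+\deg_{x_2}\tau(f)\ge\deg_{x_1}f+\deg_{x_2}f$ for every $\tau\in\mathrm{T}(R,\mathbf{x})$. $H(f)=\mathrm{Aut}(R[\mathbf{x}]/R[f])\cap\mathrm{T}(R,\mathbf{x})$. $J(R;x_i,x_j)$ is the set of $\phi\in\mathrm{Aut}(R[\mathbf{x}]/R)$ with $\phi(R[x_i])\subseteq R[x_i]$. *)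

theory Defs
  imports "HOL-Computational_Algebra.Polynomial"
begin

(* R[x1,x2] is represented as R[x1][x2]: outer variable x2, coefficients in R[x1]. *)
type_synonym 'a bpoly = "'a poly poly"

definition X1 :: "'a::comm_ring_1 bpoly" where "X1 = [:[:0, 1:]:]"
definition X2 :: "'a::comm_ring_1 bpoly" where "X2 = [:0, 1:]"
definition bconst :: "'a::comm_ring_1 \<Rightarrow> 'a bpoly" where "bconst c = [:[:c:]:]"

(* An R-algebra endomorphism phi of R[x1,x2] is given by the pair (phi(x1), phi(x2));
   bsubst f phi = phi(f) = f(phi(x1), phi(x2)). *)
definition bsubst :: "'a::comm_ring_1 bpoly \<Rightarrow> 'a bpoly \<times> 'a bpoly \<Rightarrow> 'a bpoly" where
  "bsubst f phi = poly (map_poly (\<lambda>c. poly (map_poly bconst c) (fst phi)) f) (snd phi)"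

definition bcomp :: "'a::comm_ring_1 bpoly \<times> 'a bpoly \<Rightarrow> 'a bpoly \<times> 'a bpoly \<Rightarrow> 'a bpoly \<times> 'a bpoly" where
  "bcomp phi psi = (bsubst (fst psi) phi, bsubst (snd psi) phi)"

definition bid :: "'a::comm_ring_1 bpoly \<times> 'a bpoly" where "bid = (X1, X2)"

definition is_aut :: "'a::comm_ring_1 bpoly \<times> 'a bpoly \<Rightarrow> bool" where
  "is_aut phi \<longleftrightarrow> (\<exists>psi. bcomp phi psi = bid \<and> bcomp psi phi = bid)"

definition degx1 :: "'a::zero bpoly \<Rightarrow> nat" where
  "degx1 f = Max ((\<lambda>k. degree (coeff f k)) ` {..degree f})"
definition degx2 :: "'a::zero bpoly \<Rightarrow> nat" where
  "degx2 f = degree f"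
definition degx :: "nat \<Rightarrow> 'a::zero bpoly \<Rightarrow> nat" where
  "degx i f = (if i = 1 then degx1 f else degx2 f)"

definition wdeg :: "nat \<times> nat \<Rightarrow> 'a::zero bpoly \<Rightarrow> nat" where
  "wdeg w f = (if f = 0 then 0 else
     Max {fst w * i + snd w * j | i j. coeff (coeff f j) i \<noteq> 0})"

definition weight :: "'a::zero bpoly \<Rightarrow> nat \<times> nat" where
  "weight f = (degx2 f, degx1 f)"

definition totdeg :: "'a::zero bpoly \<Rightarrow> nat" where
  "totdeg f = wdeg (1, 1) f"

definition is_affine :: "'a::comm_ring_1 bpoly \<times> 'a bpoly \<Rightarrow> bool" where
  "is_affine phi \<longleftrightarrow> is_aut phi \<and> totdeg (fst phi) = 1 \<and> totdeg (snd phi) = 1"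

definition is_elementary :: "'a::comm_ring_1 bpoly \<times> 'a bpoly \<Rightarrow> bool" where
  "is_elementary phi \<longleftrightarrow> is_aut phi \<and> (fst phi = X1 \<or> snd phi = X2)"

inductive_set gen_aut :: "('a::comm_ring_1 bpoly \<times> 'a bpoly) set \<Rightarrow> ('a bpoly \<times> 'a bpoly) set"
  for S where
  gen_id: "bid \<in> gen_aut S"
| gen_base: "phi \<in> S \<Longrightarrow> phi \<in> gen_aut S"
| gen_comp: "phi \<in> gen_aut S \<Longrightarrow> psi \<in> gen_aut S \<Longrightarrow> bcomp phi psi \<in> gen_aut S"
| gen_inv: "phi \<in> gen_aut S \<Longrightarrow> bcomp phi psi = bid \<Longrightarrow> bcomp psi phi = bid \<Longrightarrow> psi \<in> gen_aut S"

definition Aff :: "('a::comm_ring_1 bpoly \<times> 'a bpoly) set" where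
  "Aff = gen_aut {phi. is_affine phi}"

definition Tame :: "('a::comm_ring_1 bpoly \<times> 'a bpoly) set" where
  "Tame = gen_aut {phi. is_affine phi \<or> is_elementary phi}"

definition tamely_reduced :: "'a::comm_ring_1 bpoly \<Rightarrow> bool" where
  "tamely_reduced f \<longleftrightarrow> f \<notin> range bconst \<and>
     (\<forall>tau \<in> Tame. degx1 (bsubst f tau) + degx2 (bsubst f tau) \<ge> degx1 f + degx2 f)"

definition Rsub :: "'a::comm_ring_1 bpoly \<Rightarrow> 'a bpoly set" where
  "Rsub f = {poly (map_poly bconst c) f | c. True}"

definition Hset :: "'a::comm_ring_1 bpoly \<Rightarrow> ('a bpoly \<times> 'a bpoly) set" where
  "Hset f = {phi. is_aut phi \<and> (\<forall>g \<in> Rsub f. bsubst g phi = g)} \<inter> Tame"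

definition Rx :: "nat \<Rightarrow> 'a::zero bpoly set" where
  "Rx i = (if i = 1 then {g. degree g = 0} else {g. \<forall>k. degree (coeff g k) = 0})"

(* J(R; x_i, x_j) (for n = 2, the index j is determined by i) *)
definition Jset :: "nat \<Rightarrow> ('a::comm_ring_1 bpoly \<times> 'a bpoly) set" where
  "Jset i = {phi. is_aut phi \<and> (\<forall>g \<in> Rx i. bsubst g phi \<in> Rx i)}"

end

theory Submission
  imports Defs
begin

text \<open>
  Call \<open>x\<close> affine if both components have total degree at most 1, and triangular if
  \<open>x(x\<^sub>1) \<in> R[x\<^sub>1]\<close>. Every tame automorphism is a word whose letters are alternately
  non-triangular affine and non-affine triangular ones. If the top-degree part of \<open>g\<close> is
  \<open>c x\<^sub>1\<^sup>D\<close> (\<open>apex1 D g\<close>), a non-triangular affine letter produces a polynomial of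
  degree \<open>D\<close> containing \<open>x\<^sub>2\<^sup>D\<close> (\<open>apex2 D\<close>), and a non-affine triangular letter with
  \<open>x\<^sub>2 \<mapsto> w x\<^sub>2 + p(x\<^sub>1)\<close>, \<open>deg p = k \<ge> 2\<close>, takes \<open>apex2 D\<close> to \<open>apex1 (k D)\<close>. Hence the
  degree never comes back down once a word has started to act nontrivially. That the first
  letter leads to such a state is where reducedness is used: it rules out cancellation along
  the edge of the Newton triangle of \<open>f\<close>. A word fixing \<open>f\<close> therefore lies in the initial
  factor: affine for equal degrees, triangular for \<open>deg\<^bsub>x1\<^esub> f > deg\<^bsub>x2\<^esub> f\<close>; the remaining
  case follows by exchanging the variables.
\<close>

section \<open>Substitution and weighted degrees\<close>

lemma map_poly_bconst_pCons: "map_poly bconst (pCons c p) = pCons (bconst c) (map_poly bconst p)"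
  by (rule map_poly_pCons) (simp add: bconst_def)

lemma bconst_simps [simp]: "bconst 0 = 0" "bconst 1 = 1"
  "bconst (a + b) = bconst a + bconst b" "bconst (a * b) = bconst a * bconst b"
  by (simp_all add: bconst_def one_pCons)

lemma degree_map_poly_le': "degree (map_poly h p) \<le> degree p" if "h 0 = 0"
  using that by (intro degree_le) (simp add: coeff_map_poly coeff_eq_0)

lemma poly_sum_bound:
  fixes p :: "'a::comm_ring_1 poly"
  assumes "degree p \<le> n"
  shows "poly p x = (\<Sum>i\<le>n. coeff p i * x ^ i)"
  unfolding poly_altdef using assms
  by (intro sum.mono_neutral_left) (auto simp: coeff_eq_0 not_le)

lemma coeff_mult_top:
  fixes p q :: "'a::comm_ring_1 poly"
  assumes "degree p \<le> m" "degree q \<le> n"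
  shows "coeff (p * q) (m + n) = coeff p m * coeff q n"
proof -
  have "coeff (p * q) (m + n) = (\<Sum>i\<le>m + n. if i = m then coeff p m * coeff q n else 0)"
    unfolding coeff_mult
  proof (intro sum.cong refl)
    fix i
    consider "i < m" | "i = m" | "i > m" by linarith
    then show "coeff p i * coeff q (m + n - i) = (if i = m then coeff p m * coeff q n else 0)"
      using assms by cases (auto simp: coeff_eq_0)
  qed
  then show ?thesis by simp
qed

text \<open>The ring homomorphism from \<open>R[x1]\<close> to \<open>R[x1,x2]\<close> sending
  \<open>x1\<close> to \<open>F\<close>; \<open>bsubst\<close> applies it to the coefficients, so
  its laws come first.\<close>

definition esubst :: "'a::comm_ring_1 bpoly \<Rightarrow> 'a poly \<Rightarrow> 'a bpoly" where
  "esubst F c = poly (map_poly bconst c) F"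

lemma esubst_pCons: "esubst F (pCons c p) = bconst c + F * esubst F p"
  by (simp add: esubst_def map_poly_bconst_pCons)

lemma esubst_0 [simp]: "esubst F 0 = 0"
  by (simp add: esubst_def)

lemma esubst_1 [simp]: "esubst F 1 = 1"
  using esubst_pCons[of F 1 0] by (simp flip: one_pCons)

lemma esubst_add: "esubst F (p + q) = esubst F p + esubst F q"
  by (induction p q rule: poly_induct2) (simp_all add: esubst_pCons algebra_simps)

lemma esubst_smult: "esubst F (smult c p) = bconst c * esubst F p"
  by (induction p) (simp_all add: esubst_pCons algebra_simps)

lemma esubst_mult: "esubst F (p * q) = esubst F p * esubst F q"
  by (induction p) (simp_all add: esubst_pCons esubst_add esubst_smult algebra_simps)

lemma bsubst_pCons: "bsubst (pCons c f) phi = esubst (fst phi) c + snd phi * bsubst f phi"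
proof -
  have "map_poly (esubst (fst phi)) (pCons c f) = pCons (esubst (fst phi) c) (map_poly (esubst (fst phi)) f)"
    by (rule map_poly_pCons) simp
  then show ?thesis
    by (simp add: bsubst_def flip: esubst_def)
qed

lemma bsubst_0 [simp]: "bsubst 0 phi = 0"
  by (simp add: bsubst_def)

lemma bsubst_add [simp]: "bsubst (f + g) phi = bsubst f phi + bsubst g phi"
  by (induction f g rule: poly_induct2) (simp_all add: bsubst_pCons esubst_add algebra_simps)

lemma bsubst_smult: "bsubst (smult c f) phi = esubst (fst phi) c * bsubst f phi"
  by (induction f) (simp_all add: bsubst_pCons esubst_mult algebra_simps)

lemma bsubst_mult [simp]: "bsubst (f * g) phi = bsubst f phi * bsubst g phi"
  by (induction f) (simp_all add: bsubst_pCons bsubst_smult algebra_simps)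

lemma bsubst_const: "bsubst [:c:] phi = esubst (fst phi) c"
  by (simp add: bsubst_pCons)

lemma bsubst_bconst [simp]: "bsubst (bconst c) phi = bconst c"
  unfolding bconst_def bsubst_const esubst_pCons by (simp add: bconst_def)

lemma bsubst_1 [simp]: "bsubst 1 phi = 1"
  using bsubst_bconst[of 1 phi] by (simp del: bsubst_bconst)

lemma bsubst_X1 [simp]: "bsubst X1 phi = fst phi"
  by (simp add: X1_def bsubst_const esubst_pCons)

lemma bsubst_X2 [simp]: "bsubst X2 phi = snd phi"
  by (simp add: X2_def bsubst_pCons)

lemma bsubst_esubst: "bsubst (esubst F c) phi = esubst (bsubst F phi) c"
  by (induction c) (simp_all add: esubst_pCons)

text \<open>\<open>bcomp phi psi\<close> is the algebra map phi after psi, so the rightmost factor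
  of a product reaches the polynomial first.\<close>

lemma bsubst_bcomp: "bsubst f (bcomp phi psi) = bsubst (bsubst f psi) phi"
  by (induction f) (simp_all add: bsubst_pCons bsubst_esubst bcomp_def)

lemma bcomp_assoc: "bcomp (bcomp phi psi) chi = bcomp phi (bcomp psi chi)"
  by (simp add: bcomp_def bsubst_bcomp[unfolded bcomp_def])

lemma esubst_X1: "esubst X1 c = [:c:]"
  by (induction c) (simp_all add: esubst_pCons X1_def bconst_def)

lemma bsubst_bid [simp]: "bsubst f bid = f"
  by (induction f) (simp_all add: bsubst_pCons bid_def esubst_X1 X2_def)

lemma bcomp_bid [simp]: "bcomp bid phi = phi" "bcomp phi bid = phi"
  by (simp_all add: bcomp_def) (simp_all add: bid_def)

lemma coeff_esubst_sum:
  "esubst F c = (\<Sum>i\<le>degree c. bconst (coeff c i) * F ^ i)"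
proof -
  have "degree (map_poly bconst c) \<le> degree c" by (rule degree_map_poly_le') simp
  then show ?thesis unfolding esubst_def
    by (subst poly_sum_bound[of _ "degree c"]) (simp_all add: coeff_map_poly)
qed

lemma bsubst_sum:
  "bsubst f phi = (\<Sum>j\<le>degree f. \<Sum>i\<le>degree (coeff f j).
     bconst (coeff (coeff f j) i) * fst phi ^ i * snd phi ^ j)"
proof -
  have "degree (map_poly (esubst (fst phi)) f) \<le> degree f" by (rule degree_map_poly_le') simp
  then have "bsubst f phi = (\<Sum>j\<le>degree f. esubst (fst phi) (coeff f j) * snd phi ^ j)"
    unfolding bsubst_def esubst_def [symmetric]
    by (subst poly_sum_bound[of _ "degree f"]) (simp_all add: coeff_map_poly)
  then show ?thesis
    by (simp add: coeff_esubst_sum sum_distrib_right)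
qed

section \<open>Weighted degree bounds and their behaviour under substitution\<close>

definition wle :: "nat \<Rightarrow> nat \<Rightarrow> nat \<Rightarrow> 'a::zero bpoly \<Rightarrow> bool" where
  "wle p q D f \<longleftrightarrow> (\<forall>i j. coeff (coeff f j) i \<noteq> 0 \<longrightarrow> p * i + q * j \<le> D)"

lemma wleD: "wle p q D f \<Longrightarrow> coeff (coeff f j) i \<noteq> 0 \<Longrightarrow> p * i + q * j \<le> D"
  by (auto simp: wle_def)

lemma wle_mono: "wle p q D f \<Longrightarrow> D \<le> E \<Longrightarrow> wle p q E f"
  unfolding wle_def by (meson order_trans)

lemma wle_0 [simp]: "wle p q D 0"
  by (simp add: wle_def)

lemma wle_bconst [simp]: "wle p q D (bconst c)"
  by (auto simp: wle_def bconst_def coeff_pCons split: nat.splits)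

lemma wle_add: "wle p q D f \<Longrightarrow> wle p q D g \<Longrightarrow> wle p q D (f + g)"
  for f g :: "'a::comm_ring_1 bpoly"
  unfolding wle_def by (metis add.right_neutral coeff_add)

lemma wle_sum: "(\<And>x. x \<in> I \<Longrightarrow> wle p q D (f x)) \<Longrightarrow> wle p q D (sum f I)"
  for f :: "'b \<Rightarrow> 'a::comm_ring_1 bpoly"
  by (induction I rule: infinite_finite_induct) (auto intro: wle_add)

lemma wle_mult:
  fixes f g :: "'a::comm_ring_1 bpoly"
  assumes "wle p q D f" "wle p q E g"
  shows "wle p q (D + E) (f * g)"
  unfolding wle_def
proof (intro allI impI)
  fix i j assume "coeff (coeff (f * g) j) i \<noteq> 0"
  then have "(\<Sum>s\<le>j. \<Sum>t\<le>i. coeff (coeff f s) t * coeff (coeff g (j - s)) (i - t)) \<noteq> 0"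
    by (simp add: coeff_mult coeff_sum)
  then obtain s where s: "s \<le> j"
    "(\<Sum>t\<le>i. coeff (coeff f s) t * coeff (coeff g (j - s)) (i - t)) \<noteq> 0"
    by (meson atMost_iff sum.not_neutral_contains_not_neutral)
  then obtain t where t: "t \<le> i" "coeff (coeff f s) t * coeff (coeff g (j - s)) (i - t) \<noteq> 0"
    by (meson atMost_iff sum.not_neutral_contains_not_neutral)
  from t(2) have "coeff (coeff f s) t \<noteq> 0" "coeff (coeff g (j - s)) (i - t) \<noteq> 0" by auto
  with assms have *: "p * t + q * s \<le> D" "p * (i - t) + q * (j - s) \<le> E"
    by (auto dest: wleD)
  have "p * i + q * j = (p * t + q * s) + (p * (i - t) + q * (j - s))"
    using s(1) t(1) by (metis (no_types, lifting) add.commute add.left_commute distrib_left le_add_diff_inverse)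
  with * show "p * i + q * j \<le> D + E" by linarith
qed

lemma wle_power: "wle p q D f \<Longrightarrow> wle p q (D * n) (f ^ n)"
  for f :: "'a::comm_ring_1 bpoly"
proof (induction n)
  case 0 then show ?case using wle_bconst[of p q 0 1] by simp
next
  case (Suc n) then show ?case using wle_mult[of p q D f "D * n" "f ^ n"] by simp
qed

text \<open>When the images of \<open>x1\<close> and \<open>x2\<close> have weight at most
  \<open>p'\<close> and \<open>q'\<close>, the monomial \<open>x1^i x2^j\<close> goes to weight at
  most \<open>p' i + q' j\<close>. Different choices of weights give the different degree bounds
  below.\<close>

lemma wle_bsubst:
  fixes f :: "'a::comm_ring_1 bpoly"
  assumes "wle p' q' D f" "wle p q p' (fst phi)" "wle p q q' (snd phi)"
  shows "wle p q D (bsubst f phi)"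
  unfolding bsubst_sum
proof (intro wle_sum)
  fix j i
  show "wle p q D (bconst (coeff (coeff f j) i) * fst phi ^ i * snd phi ^ j)"
  proof (cases "coeff (coeff f j) i = 0")
    case False
    have "wle p q (0 + p' * i + q' * j) (bconst (coeff (coeff f j) i) * fst phi ^ i * snd phi ^ j)"
      by (intro wle_mult wle_power wle_bconst assms)
    then show ?thesis using wleD[OF assms(1) False] by (auto intro: wle_mono)
  qed simp
qed

lemma coeff_power_mult_top:
  fixes F G :: "'a::idom poly"
  assumes "degree F \<le> m" "degree G \<le> n"
  shows "degree (F ^ i * G ^ j) \<le> m * i + n * j"
    and "coeff (F ^ i * G ^ j) (m * i + n * j) = coeff F m ^ i * coeff G n ^ j"
proof -
  have pw: "degree (H ^ i) \<le> m * i \<and> coeff (H ^ i) (m * i) = coeff H m ^ i"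
    if "degree H \<le> m" for H :: "'a poly" and m i
  proof (induction i)
    case (Suc i)
    have "degree (H * H ^ i) \<le> m + m * i"
      using degree_mult_le[of H "H ^ i"] Suc that by linarith
    moreover have "coeff (H * H ^ i) (m + m * i) = coeff H m * coeff (H ^ i) (m * i)"
      using Suc that by (intro coeff_mult_top) auto
    ultimately show ?case using Suc by simp
  qed simp
  show "degree (F ^ i * G ^ j) \<le> m * i + n * j"
    using degree_mult_le[of "F ^ i" "G ^ j"] pw[OF assms(1), of i] pw[OF assms(2), of j] by linarith
  show "coeff (F ^ i * G ^ j) (m * i + n * j) = coeff F m ^ i * coeff G n ^ j"
    using coeff_mult_top[of "F ^ i" "m * i" "G ^ j" "n * j"] pw[OF assms(1), of i] pw[OF assms(2), of j]
    by simp
qed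

section \<open>Affine and triangular automorphisms acting on leading terms\<close>

text \<open>Under \<open>h\<close> after \<open>phi\<close>, a monomial of weight below
  \<open>m * i0 + n * j0\<close> has degree below that number, and by \<open>uniq\<close> only one
  monomial has exactly this weight, so nothing cancels. In the applications \<open>h\<close>
  restricts to an axis, \<open>x1 = 0\<close> or \<open>x2 = 0\<close>.\<close>

lemma top_coeff:
  fixes h :: "'a::idom bpoly \<Rightarrow> 'a poly"
  assumes h: "\<And>x y. h (x + y) = h x + h y" "\<And>x y. h (x * y) = h x * h y" "\<And>c. h (bconst c) = [:c:]"
    and deg: "degree (h (fst phi)) \<le> m" "degree (h (snd phi)) \<le> n"
    and f: "wle m n (m * i0 + n * j0) f" "coeff (coeff f j0) i0 \<noteq> 0"
    and uniq: "\<And>i j. coeff (coeff f j) i \<noteq> 0 \<Longrightarrow> m * i + n * j = m * i0 + n * j0 \<Longrightarrow> i = i0 \<and> j = j0"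
  shows "coeff (h (bsubst f phi)) (m * i0 + n * j0)
    = coeff (coeff f j0) i0 * coeff (h (fst phi)) m ^ i0 * coeff (h (snd phi)) n ^ j0"
proof -
  define N where "N = m * i0 + n * j0"
  have h0: "h 0 = 0" using h(3)[of 0] by simp
  have h1: "h 1 = 1" using h(3)[of 1] by (simp add: one_pCons)
  have hsum: "h (sum F I) = (\<Sum>x\<in>I. h (F x))" for F :: "nat \<Rightarrow> 'a bpoly" and I
    by (induction I rule: infinite_finite_induct) (simp_all add: h0 h(1))
  have hpow: "h (F ^ k) = h F ^ k" for F k
    by (induction k) (simp_all add: h1 h(2))
  let ?c = "\<lambda>i j. coeff (coeff f j) i"
  let ?T = "?c i0 j0 * coeff (h (fst phi)) m ^ i0 * coeff (h (snd phi)) n ^ j0"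
  have summand: "coeff (h (bconst (?c i j) * fst phi ^ i * snd phi ^ j)) N
      = (if j = j0 then if i = i0 then ?T else 0 else 0)" for i j
  proof -
    have eq: "coeff (h (bconst (?c i j) * fst phi ^ i * snd phi ^ j)) N
        = ?c i j * coeff (h (fst phi) ^ i * h (snd phi) ^ j) N"
      by (simp add: h hpow mult.assoc)
    show ?thesis
    proof (cases "?c i j = 0")
      case True
      then show ?thesis using f(2) eq by auto
    next
      case False
      then consider "m * i + n * j < N" | "i = i0" "j = j0"
        using wleD[OF f(1) False] uniq[OF False] unfolding N_def by linarith
      then show ?thesis
      proof cases
        case 1
        then have "coeff (h (fst phi) ^ i * h (snd phi) ^ j) N = 0"
          using coeff_power_mult_top(1)[OF deg, of i j] by (intro coeff_eq_0) linarith
        then show ?thesis using 1 eq by (auto simp: N_def)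
      next
        case 2
        then show ?thesis
          using eq coeff_power_mult_top(2)[OF deg, of i0 j0] by (simp add: N_def mult.assoc)
      qed
    qed
  qed
  have ranges: "j0 \<le> degree f" "i0 \<le> degree (coeff f j0)"
    using f(2) by (auto intro!: le_degree)
  have "coeff (h (bsubst f phi)) N =
      (\<Sum>j\<le>degree f. \<Sum>i\<le>degree (coeff f j). if j = j0 then if i = i0 then ?T else 0 else 0)"
    by (simp only: bsubst_sum hsum coeff_sum summand)
  also have "\<dots> = (\<Sum>j\<le>degree f. if j = j0 then ?T else 0)"
    using ranges(2) by (intro sum.cong) auto
  also have "\<dots> = ?T"
    using ranges(1) by simp
  finally show ?thesis unfolding N_def .
qed

definition at_x1_0 :: "'a::comm_ring_1 bpoly \<Rightarrow> 'a poly" where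
  "at_x1_0 = map_poly (\<lambda>c. coeff c 0)"

lemma coeff_at_x1_0: "coeff (at_x1_0 f) j = coeff (coeff f j) 0"
  by (simp add: at_x1_0_def coeff_map_poly)

lemma at_x1_0_hom:
  "at_x1_0 (f + g) = at_x1_0 f + at_x1_0 g"
  "at_x1_0 (f * g) = at_x1_0 f * at_x1_0 g"
  "at_x1_0 (bconst c) = [:c:]"
  by (auto simp: poly_eq_iff coeff_at_x1_0 coeff_mult coeff_sum bconst_def coeff_pCons split: nat.splits)

definition apex1 :: "nat \<Rightarrow> 'a::zero bpoly \<Rightarrow> bool" where
  "apex1 D f \<longleftrightarrow> wle 1 1 D f \<and> coeff (coeff f 0) D \<noteq> 0 \<and>
     (\<forall>i j. coeff (coeff f j) i \<noteq> 0 \<longrightarrow> i + j = D \<longrightarrow> j = 0)"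

text \<open>Other monomials of degree \<open>D\<close> may occur here, in contrast to
  \<open>apex1\<close>. The weights \<open>(1, k)\<close> of a triangular letter single out the
  vertex \<open>(0, D)\<close> anyway, whereas an affine letter could cancel terms if the top form
  had several monomials.\<close>

definition apex2 :: "nat \<Rightarrow> 'a::zero bpoly \<Rightarrow> bool" where
  "apex2 D f \<longleftrightarrow> wle 1 1 D f \<and> coeff (coeff f D) 0 \<noteq> 0"

text \<open>An inequality is used because it passes through \<open>wle_bsubst\<close>; for
  automorphisms over an integral domain the total degree is then exactly 1.\<close>

definition affs :: "('a::comm_ring_1 bpoly \<times> 'a bpoly) set" where
  "affs = {phi. is_aut phi \<and> wle 1 1 1 (fst phi) \<and> wle 1 1 1 (snd phi)}"

definition trgs :: "('a::comm_ring_1 bpoly \<times> 'a bpoly) set" where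
  "trgs = {phi. is_aut phi \<and> degree (fst phi) = 0}"

text \<open>Not being triangular means that \<open>fst phi\<close> contains \<open>beta x2\<close>
  with \<open>beta \<noteq> 0\<close>; the top form \<open>c x1^D\<close> thus yields the monomial
  \<open>c beta^D x2^D\<close>.\<close>

lemma apex2_affine:
  fixes f :: "'a::idom bpoly"
  assumes "phi \<in> affs - trgs" "apex1 D f"
  shows "apex2 D (bsubst f phi)"
proof -
  have lin: "wle 1 1 1 (fst phi)" "wle 1 1 1 (snd phi)" and d: "degree (fst phi) \<noteq> 0"
    using assms(1) by (auto simp: affs_def trgs_def)
  have f: "wle 1 1 D f" "coeff (coeff f 0) D \<noteq> 0"
    "\<And>i j. coeff (coeff f j) i \<noteq> 0 \<Longrightarrow> i + j = D \<Longrightarrow> j = 0"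
    using assms(2) by (auto simp: apex1_def)
  have deg: "degree (at_x1_0 g) \<le> 1" if "wle 1 1 1 g" for g :: "'a bpoly"
    using wleD[OF that] by (intro degree_le) (force simp: coeff_at_x1_0)
  \<comment> \<open>The leading coefficient in \<open>x2\<close> is nonzero, and total degree at
    most 1 leaves only the monomial \<open>x2\<close> for it.\<close>
  have "coeff (fst phi) (degree (fst phi)) \<noteq> 0"
    using d by auto
  then have "coeff (coeff (fst phi) (degree (fst phi))) (degree (coeff (fst phi) (degree (fst phi)))) \<noteq> 0"
    by simp
  moreover from wleD[OF lin(1) this] d
  have "degree (fst phi) = 1" "degree (coeff (fst phi) (degree (fst phi))) = 0" by auto
  ultimately have beta: "coeff (coeff (fst phi) 1) 0 \<noteq> 0"
    by metis
  have "coeff (at_x1_0 (bsubst f phi)) (1 * D + 1 * 0)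
     = coeff (coeff f 0) D * coeff (at_x1_0 (fst phi)) 1 ^ D * coeff (at_x1_0 (snd phi)) 1 ^ 0"
  proof (rule top_coeff)
    show "i = D \<and> j = 0" if "coeff (coeff f j) i \<noteq> 0" "1 * i + 1 * j = 1 * D + 1 * 0" for i j
      using f(3)[OF that(1)] that(2) by auto
  qed (use f in \<open>auto simp: at_x1_0_hom intro!: deg[unfolded One_nat_def] lin[unfolded One_nat_def]\<close>)
  then have "coeff (coeff (bsubst f phi) D) 0 \<noteq> 0"
    using beta f(2) by (simp add: coeff_at_x1_0)
  moreover have "wle 1 1 D (bsubst f phi)"
    by (rule wle_bsubst[OF f(1) lin])
  ultimately show ?thesis by (simp add: apex2_def)
qed

text \<open>For the weights \<open>(1, k)\<close> the vertex \<open>(0, D)\<close> is the only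
  monomial of \<open>f\<close> of maximal weight. It contributes a multiple of
  \<open>snd phi ^ D\<close>, where \<open>p^D\<close> supplies the pure power of
  \<open>x1\<close>.\<close>

lemma apex1_triangular:
  fixes f :: "'a::idom bpoly"
  assumes fst: "fst phi = [:[:v, u:]:]" and snd: "snd phi = [:p, [:w:]:]"
    and k: "degree p \<ge> 2" "k = degree p"
    and f: "wle 1 k (k * D) f" "coeff (coeff f D) 0 \<noteq> 0"
    and uniq: "\<And>i j. coeff (coeff f j) i \<noteq> 0 \<Longrightarrow> i + k * j = k * D \<Longrightarrow> i = 0"
  shows "apex1 (k * D) (bsubst f phi)"
proof -
  have "wle 1 k 1 (fst phi)"
    by (auto simp: wle_def fst coeff_pCons split: nat.splits)
  moreover have "wle 1 k k (snd phi)"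
    using k by (auto simp: wle_def snd coeff_pCons le_degree split: nat.splits)
  ultimately have wle: "wle 1 k (k * D) (bsubst f phi)"
    by (rule wle_bsubst[OF f(1)])
  \<comment> \<open>Taking the coefficient at 0 restricts to the axis \<open>x2 = 0\<close>, where
    \<open>snd phi\<close> becomes \<open>p\<close>.\<close>
  have "coeff (coeff (bsubst f phi) 0) (1 * 0 + k * D)
      = coeff (coeff f D) 0 * coeff (coeff (fst phi) 0) 1 ^ 0 * coeff (coeff (snd phi) 0) k ^ D"
  proof (rule top_coeff)
    show "i = 0 \<and> j = D" if "coeff (coeff f j) i \<noteq> 0" "1 * i + k * j = 1 * 0 + k * D" for i j
      using uniq[OF that(1)] that(2) k by auto
  qed (use f in \<open>auto simp: coeff_mult_0 bconst_def fst snd simp flip: k(2)\<close>)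
  moreover have "coeff p k \<noteq> 0" using k by auto
  ultimately have "coeff (coeff (bsubst f phi) 0) (k * D) \<noteq> 0"
    using f(2) by (simp add: snd)
  moreover have "i + j \<le> k * D" "i + j = k * D \<Longrightarrow> j = 0"
    if "coeff (coeff (bsubst f phi) j) i \<noteq> 0" for i j
  proof -
    have le: "i + k * j \<le> k * D" using wleD[OF wle that] by simp
    \<comment> \<open>Because \<open>k \<ge> 2\<close>, the bound
      \<open>i + k * j \<le> k * D\<close> admits \<open>i + j = k * D\<close> only for
      \<open>j = 0\<close>.\<close>
    have "2 * j \<le> k * j" using k by (intro mult_right_mono) auto
    then show "i + j \<le> k * D" "i + j = k * D \<Longrightarrow> j = 0"
      using le by linarith+
  qed
  ultimately show ?thesis by (auto simp: apex1_def wle_def)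
qed

section \<open>Triangular automorphisms and their inverses\<close>

lemma esubst_as_pcompose:
  "esubst F c = pcompose (map_poly (\<lambda>a. [:a:]) c) F" 
  by (induction c) (simp_all add: esubst_pCons map_poly_pCons pcompose_pCons bconst_def)

lemma esubst_const: "esubst [:q:] c = [:pcompose c q:]"
  by (induction c) (simp_all add: esubst_pCons pcompose_pCons bconst_def)

text \<open>Over \<open>R[x1]\<close> such a substitution is a composition of polynomials in
  \<open>x2\<close>, which makes the degrees in \<open>x2\<close> multiply.\<close>

lemma bsubst_as_pcompose:
  "bsubst g ([:q:], G) = pcompose (map_poly (\<lambda>c. pcompose c q) g) G"
  by (induction g) (simp_all add: bsubst_pCons esubst_const map_poly_pCons pcompose_pCons)

text \<open>Degrees multiply under composition of univariate polynomials, so in \<open>psi (phi (x\<^sub>i)) = x\<^sub>i\<close> every factor has degree at most 1.\<close>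

lemma trgs_structure:
  fixes phi :: "'a::idom bpoly \<times> 'a bpoly"
  assumes inv: "bcomp psi phi = bid" and deg0: "degree (fst phi) = 0"
  obtains v u p w where "fst phi = [:[:v, u:]:]" "snd phi = [:p, [:w:]:]" "degree (fst psi) = 0"
proof -
  from deg0 obtain P where P: "fst phi = [:P:]" by (metis degree_eq_zeroE)
  have e: "esubst (fst psi) P = X1" and e2: "bsubst (snd phi) psi = X2"
    using inv by (simp_all add: bcomp_def P bid_def bsubst_const)
  have "degree (map_poly (\<lambda>a. [:a:]) P) = degree P"
    by (rule degree_map_poly) auto
  then have "degree P * degree (fst psi) = degree (X1 :: 'a bpoly)"
    using e by (metis esubst_as_pcompose degree_pcompose)
  then have "degree P * degree (fst psi) = 0" by (simp add: X1_def)
  moreover have "degree P \<noteq> 0"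
  proof
    assume "degree P = 0"
    then obtain c where "P = [:c:]" by (metis degree_eq_zeroE)
    then show False using e by (simp add: esubst_pCons X1_def bconst_def)
  qed
  ultimately have d0: "degree (fst psi) = 0" by simp
  then obtain q where q: "fst psi = [:q:]" by (metis degree_eq_zeroE)
  have "pcompose P q = [:0, 1:]"
    using e by (simp add: q esubst_const X1_def)
  then have "degree P * degree q = 1" by (metis degree_pcompose degree_pCons_eq_if degree_1 one_neq_zero One_nat_def degree_0 one_pCons pCons_eq_0_iff)
  then have dP: "degree P = 1" and dq: "degree q = 1" by auto
  define G where "G = map_poly (\<lambda>c. pcompose c q) (snd phi)"
  have GX: "pcompose G (snd psi) = X2"
    using e2 bsubst_as_pcompose[of "snd phi" q "snd psi"] by (simp add: G_def flip: q)
  have "degree G * degree (snd psi) = degree (X2 :: 'a bpoly)"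
    by (metis GX degree_pcompose)
  then have dG: "degree G = 1" "degree (snd psi) = 1" by (auto simp: X2_def)
  have "degree G = degree (snd phi)"
    unfolding G_def using dq by (intro degree_map_poly) (auto dest: pcompose_eq_0)
  then have "degree (snd phi) = 1" using dG by simp
  then obtain p r where r: "snd phi = [:p, r:]"
    by (metis degree1_coeffs)
  obtain h0 h1 where h: "snd psi = [:h0, h1:]"
    using dG by (metis degree1_coeffs)
  have "G = [:pcompose p q, pcompose r q:]"
    by (simp add: G_def r map_poly_pCons)
  \<comment> \<open>Comparing the coefficients of \<open>x2\<close> shows that
    \<open>pcompose r q\<close> is a unit, hence constant; as \<open>q\<close> has degree 1, so is
    \<open>r\<close>.\<close>
  then have "pcompose r q * h1 = 1"
    using GX by (simp add: h X2_def pcompose_pCons)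
  then have "degree (pcompose r q) = 0"
    by (metis degree_1 degree_mult_eq_0 is_unit_iff_degree degree_mult_eq add_is_0 mult_zero_left mult_zero_right zero_neq_one)
  then have "degree r = 0" using dq by (simp add: degree_pcompose)
  then obtain w where "r = [:w:]" by (metis degree_eq_zeroE)
  moreover obtain v u where "P = [:v, u:]" using dP by (metis degree1_coeffs)
  ultimately show ?thesis using that P r d0 by blast
qed

section \<open>Alternating words\<close>

abbreviation inverses :: "'a::comm_ring_1 bpoly \<times> 'a bpoly \<Rightarrow> 'a bpoly \<times> 'a bpoly \<Rightarrow> bool" where
  "inverses phi psi \<equiv> bcomp phi psi = bid \<and> bcomp psi phi = bid"

text \<open>Abstract in the two groups, because the cases of equal and unequal degrees need words
  whose first factor comes from different groups.\<close>

locale automorphism_groups =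
  fixes A B :: "('a::comm_ring_1 bpoly \<times> 'a bpoly) set"
  assumes comp_A: "x \<in> A \<Longrightarrow> y \<in> A \<Longrightarrow> bcomp x y \<in> A"
    and comp_B: "x \<in> B \<Longrightarrow> y \<in> B \<Longrightarrow> bcomp x y \<in> B"
    and inv_A: "x \<in> A \<Longrightarrow> \<exists>y\<in>A. inverses x y"
    and inv_B: "x \<in> B \<Longrightarrow> \<exists>y\<in>B. inverses x y"
    and bid_B: "bid \<in> B"
begin

text \<open>The subscript names the group of the leftmost letter, which acts last. The first factor
  to act is any element of \<open>B\<close>, possibly in \<open>A\<close>; all later letters avoid
  \<open>A \<inter> B\<close>.\<close>

inductive words_A and words_B where
  base: "x \<in> A - B \<Longrightarrow> m \<in> B \<Longrightarrow> words_A (bcomp x m)"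
| step_A: "x \<in> A - B \<Longrightarrow> words_B m \<Longrightarrow> words_A (bcomp x m)"
| step_B: "x \<in> B - A \<Longrightarrow> words_A m \<Longrightarrow> words_B (bcomp x m)"

text \<open>An element of \<open>A \<inter> B\<close> has an inverse in each group, so
  multiplication by it can be undone inside either group.\<close>

lemma comp_diff:
  assumes "c \<in> A" "c \<in> B"
  shows "x \<in> A - B \<Longrightarrow> bcomp c x \<in> A - B" "x \<in> B - A \<Longrightarrow> bcomp c x \<in> B - A"
proof -
  obtain c1 where c1: "c1 \<in> A" "inverses c c1" using inv_A assms by blast
  obtain c2 where c2: "c2 \<in> B" "inverses c c2" using inv_B assms by blast
  have cancel: "bcomp c1 (bcomp c x) = x" "bcomp c2 (bcomp c x) = x"
    using c1 c2 by (simp_all flip: bcomp_assoc)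
  show "bcomp c x \<in> A - B" if "x \<in> A - B"
    using that assms comp_A[of c x] comp_B[OF c2(1), of "bcomp c x"] cancel by auto
  show "bcomp c x \<in> B - A" if "x \<in> B - A"
    using that assms comp_B[of c x] comp_A[OF c1(1), of "bcomp c x"] cancel by auto
qed

text \<open>The leftmost letter absorbs \<open>c\<close>.\<close>

lemma comp_words:
  assumes "c \<in> A" "c \<in> B"
  shows "words_A m \<Longrightarrow> words_A (bcomp c m)" "words_B m \<Longrightarrow> words_B (bcomp c m)"
proof -
  show "words_A (bcomp c m)" if "words_A m"
    using that
  proof cases
    case (base x m')
    then show ?thesis using words_A_words_B.base[OF comp_diff(1)[OF assms]] by (simp add: bcomp_assoc)
  next
    case (step_A x m')
    then show ?thesis using words_A_words_B.step_A[OF comp_diff(1)[OF assms]] by (simp add: bcomp_assoc)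
  qed
  show "words_B (bcomp c m)" if "words_B m"
    using that
  proof cases
    case (step_B x m')
    then show ?thesis using words_A_words_B.step_B[OF comp_diff(2)[OF assms]] by (simp add: bcomp_assoc)
  qed
qed

text \<open>Words start with an element of \<open>B\<close> as the rightmost factor, which acts first on polynomials.\<close>

definition words where "words = {m. m \<in> B \<or> words_A m \<or> words_B m}"

text \<open>If the leftmost letter belongs to \<open>A\<close>, its product with \<open>x\<close> is
  either a letter again or lies in \<open>A \<inter> B\<close> and is absorbed by the rest of the
  word. In the other cases \<open>x\<close> itself is prepended or absorbed.\<close>

lemma words_comp_A:
  assumes x: "x \<in> A" and m: "m \<in> words"
  shows "bcomp x m \<in> words"
proof -
  consider "m \<in> B" | "words_A m" | "words_B m" using m by (auto simp: words_def)
  then show ?thesis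
  proof cases
    case 2
    then obtain y m' where y: "y \<in> A - B" "m' \<in> B \<or> words_B m'" "m = bcomp y m'"
      by (rule words_A.cases) blast+
    then have "bcomp x y \<in> A" using comp_A x by auto
    moreover have "bcomp x m = bcomp (bcomp x y) m'" by (simp add: y bcomp_assoc)
    ultimately show ?thesis
      using y(2) comp_B[of "bcomp x y" m'] comp_words(2)[of "bcomp x y" m'] by (cases "bcomp x y \<in> B") (auto simp: words_def intro: base step_A)
  qed (use x comp_B comp_words in \<open>cases "x \<in> B"; auto simp: words_def intro: base step_A\<close>)+
qed

lemma words_comp_B:
  assumes x: "x \<in> B" and m: "m \<in> words"
  shows "bcomp x m \<in> words"
proof -
  consider "m \<in> B" | "words_A m" | "words_B m" using m by (auto simp: words_def)
  then show ?thesis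
  proof cases
    case 3
    then obtain y m' where y: "y \<in> B - A" "words_A m'" "m = bcomp y m'"
      by (rule words_B.cases) blast
    then have "bcomp x y \<in> B" using comp_B x by auto
    moreover have "bcomp x m = bcomp (bcomp x y) m'" by (simp add: y bcomp_assoc)
    ultimately show ?thesis
      using y(2) comp_words(1)[of "bcomp x y" m'] by (cases "bcomp x y \<in> A") (auto simp: words_def intro: step_B)
  qed (use x comp_B comp_words in \<open>cases "x \<in> A"; auto simp: words_def intro: step_B\<close>)+
qed

text \<open>The inverse is included because \<^const>\<open>gen_aut\<close> is closed under inverses.\<close>

definition stabilizer where
  "stabilizer = {x. \<exists>y. inverses x y \<and> (\<forall>m\<in>words. bcomp x m \<in> words \<and> bcomp y m \<in> words)}"

lemma stabilizerI:
  assumes "inverses x y" "\<And>m. m \<in> words \<Longrightarrow> bcomp x m \<in> words" "\<And>m. m \<in> words \<Longrightarrow> bcomp y m \<in> words"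
  shows "x \<in> stabilizer"
  using assms unfolding stabilizer_def by blast

lemma subset_stabilizer: "A \<subseteq> stabilizer" "B \<subseteq> stabilizer"
  using inv_A inv_B words_comp_A words_comp_B unfolding stabilizer_def by blast+

lemma stabilizer_comp:
  assumes "x \<in> stabilizer" "y \<in> stabilizer"
  shows "bcomp x y \<in> stabilizer"
proof -
  obtain x' y' where
    x: "inverses x x'" "\<forall>m\<in>words. bcomp x m \<in> words \<and> bcomp x' m \<in> words" and
    y: "inverses y y'" "\<forall>m\<in>words. bcomp y m \<in> words \<and> bcomp y' m \<in> words"
    using assms by (auto simp: stabilizer_def)
  have "inverses (bcomp x y) (bcomp y' x')"
    using x(1) y(1) by (metis bcomp_assoc bcomp_bid)
  then show ?thesis
    by (rule stabilizerI) (use x(2) y(2) in \<open>simp_all add: bcomp_assoc\<close>)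
qed

text \<open>The stabilizer is closed under all rules of generation, which is not evident for the
  words themselves; applying its elements to the word \<open>bid\<close> shows that they are
  words.\<close>

lemma gen_aut_words:
  assumes "S \<subseteq> stabilizer"
  shows "gen_aut S \<subseteq> words"
proof -
  have "phi \<in> stabilizer" if "phi \<in> gen_aut S" for phi
    using that
  proof induction
    case gen_id
    then show ?case using bid_B subset_stabilizer by auto
  next
    case (gen_inv phi psi)
    then obtain y where y: "inverses phi y" "\<forall>m\<in>words. bcomp phi m \<in> words \<and> bcomp y m \<in> words"
      by (auto simp: stabilizer_def)
    \<comment> \<open>Inverses are unique.\<close>
    have "y = psi" using y(1) gen_inv by (metis bcomp_assoc bcomp_bid)
    with y gen_inv show ?case by (intro stabilizerI[of psi phi]) auto
  qed (use assms stabilizer_comp in auto)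
  moreover have "phi \<in> words" if "phi \<in> stabilizer" for phi
  proof -
    have "bid \<in> words" using bid_B by (simp add: words_def)
    with that have "bcomp phi bid \<in> words" unfolding stabilizer_def by blast
    then show ?thesis by simp
  qed
  ultimately show ?thesis by auto
qed

end

section \<open>The groups of affine and of triangular automorphisms\<close>

lemma inverses_is_aut: "inverses x y \<Longrightarrow> is_aut x" "inverses x y \<Longrightarrow> is_aut y"
  unfolding is_aut_def by blast+

lemma is_aut_comp: "is_aut x \<Longrightarrow> is_aut y \<Longrightarrow> is_aut (bcomp x y)"
proof -
  assume "is_aut x" "is_aut y"
  then obtain x' y' where "inverses x x'" "inverses y y'" by (auto simp: is_aut_def)
  then have "inverses (bcomp x y) (bcomp y' x')" by (metis bcomp_assoc bcomp_bid)
  then show ?thesis by (rule inverses_is_aut)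
qed

text \<open>The weights \<open>(0, 1)\<close> measure the degree in \<open>x2\<close>, so that
  \<open>wle_bsubst\<close> applies to triangularity.\<close>

lemma wle_degree_0_iff: "wle 0 1 0 f \<longleftrightarrow> degree f = 0"
proof
  assume w: "wle 0 1 0 f"
  show "degree f = 0"
  proof (rule ccontr)
    assume "degree f \<noteq> 0"
    then have "coeff f (degree f) \<noteq> 0" by auto
    then have "coeff (coeff f (degree f)) (degree (coeff f (degree f))) \<noteq> 0" by simp
    from wleD[OF w this] \<open>degree f \<noteq> 0\<close> show False by simp
  qed
next
  assume "degree f = 0"
  then obtain c where "f = [:c:]" by (metis degree_eq_zeroE)
  then show "wle 0 1 0 f" by (auto simp: wle_def coeff_pCons split: nat.splits)
qed

lemma trgs_comp:
  assumes "x \<in> trgs" "y \<in> trgs"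
  shows "bcomp x y \<in> trgs"
proof -
  have x: "wle 0 1 0 (fst x)" and y: "wle 0 1 0 (fst y)" using assms unfolding wle_degree_0_iff by (auto simp: trgs_def)
  have "wle 0 1 (degree (snd x)) (snd x)"
    by (auto simp: wle_def intro!: le_degree)
  \<comment> \<open>Any weight may be given to \<open>x2\<close>, since it does not occur in
    \<open>fst y\<close>.\<close>
  moreover have "wle 0 (degree (snd x)) 0 (fst y)"
    using y by (auto simp: wle_def)
  ultimately have "wle 0 1 0 (bsubst (fst y) x)"
    using x by (intro wle_bsubst) auto
  then have "degree (fst (bcomp x y)) = 0"
    unfolding wle_degree_0_iff by (simp add: bcomp_def)
  moreover have "is_aut (bcomp x y)"
    using assms is_aut_comp[of x y] by (simp add: trgs_def)
  ultimately show ?thesis by (simp add: trgs_def)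
qed

lemma affs_comp: "x \<in> affs \<Longrightarrow> y \<in> affs \<Longrightarrow> bcomp x y \<in> affs"
  by (auto simp: affs_def is_aut_comp) (auto simp: bcomp_def intro!: wle_bsubst[of 1 1, unfolded One_nat_def])

lemma bid_in: "bid \<in> trgs" "bid \<in> affs"
proof -
  have "is_aut bid" by (rule inverses_is_aut[of bid bid]) simp
  then show "bid \<in> trgs" "bid \<in> affs"
    by (auto simp: trgs_def affs_def bid_def wle_def X1_def X2_def coeff_pCons split: nat.splits if_splits)
qed

lemma trgs_inverse:
  fixes x :: "'a::idom bpoly \<times> 'a bpoly"
  assumes "x \<in> trgs"
  shows "\<exists>y\<in>trgs. inverses x y"
proof -
  obtain y where y: "inverses x y" using assms by (auto simp: trgs_def is_aut_def)
  have "degree (fst y) = 0"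
    using trgs_structure[of y x] y assms by (auto simp: trgs_def)
  then have "y \<in> trgs" using inverses_is_aut(2)[OF y] by (simp add: trgs_def)
  with y show ?thesis by blast
qed

lemma linear_form:
  assumes "wle 1 1 1 F"
  shows "F = [:[:coeff (coeff F 0) 0, coeff (coeff F 0) 1:], [:coeff (coeff F 1) 0:]:]"
proof -
  have "coeff (coeff F j) i = 0" if "i + j > 1" for i j
    using wleD[OF assms, of j i] that by force
  then show ?thesis
    by (auto simp: poly_eq_iff coeff_pCons split: nat.splits)
qed

lemma bsubst_linear:
  "bsubst [:[:e, a:], [:b:]:] psi = bconst e + bconst a * fst psi + bconst b * snd psi"
  by (simp add: bsubst_pCons esubst_pCons algebra_simps)

lemma coeff_bconst_mult: "coeff (coeff (bconst c * g) j) i = c * coeff (coeff g j) i"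
  by (simp add: bconst_def)

text \<open>The linear parts of \<open>x\<close> and of its inverse are inverse matrices, so the
  determinant is nonzero. The higher coefficients of the inverse solve a homogeneous system and
  vanish by Cramer's rule.\<close>

lemma affs_inverse:
  fixes x :: "'a::idom bpoly \<times> 'a bpoly"
  assumes "x \<in> affs"
  shows "\<exists>y\<in>affs. inverses x y"
proof -
  obtain y where y: "inverses x y" using assms by (auto simp: affs_def is_aut_def)
  obtain e a b where x1: "fst x = [:[:e, a:], [:b:]:]"
    using assms linear_form by (fastforce simp: affs_def)
  obtain e' c d where x2: "snd x = [:[:e', c:], [:d:]:]"
    using assms linear_form by (fastforce simp: affs_def)
  have 1: "bconst e + bconst a * fst y + bconst b * snd y = X1"
    and 2: "bconst e' + bconst c * fst y + bconst d * snd y = X2"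
    using y bsubst_linear[of e a b y] bsubst_linear[of e' c d y] by (auto simp: bcomp_def bid_def x1 x2)
  define r s where "r i j = coeff (coeff (fst y) j) i" and "s i j = coeff (coeff (snd y) j) i" for i j
  have row1: "a * r i j + b * s i j = (if (i, j) = (1, 0) then 1 else 0)" if "(i, j) \<noteq> (0, 0)" for i j
    using arg_cong[OF 1, of "\<lambda>f. coeff (coeff f j) i"] that
    by (auto simp: coeff_bconst_mult r_def s_def) (auto simp: bconst_def X1_def coeff_pCons split: nat.splits)
  have row2: "c * r i j + d * s i j = (if (i, j) = (0, 1) then 1 else 0)" if "(i, j) \<noteq> (0, 0)" for i j
    using arg_cong[OF 2, of "\<lambda>f. coeff (coeff f j) i"] that
    by (auto simp: coeff_bconst_mult r_def s_def) (auto simp: bconst_def X2_def coeff_pCons split: nat.splits)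
  \<comment> \<open>Multiplicativity of the determinant for two 2 by 2 matrices.\<close>
  have "(a * d - b * c) * (r 1 0 * s 0 1 - r 0 1 * s 1 0)
    = (a * r 1 0 + b * s 1 0) * (c * r 0 1 + d * s 0 1) - (a * r 0 1 + b * s 0 1) * (c * r 1 0 + d * s 1 0)"
    by algebra
  then have "(a * d - b * c) * (r 1 0 * s 0 1 - r 0 1 * s 1 0) = 1"
    using row1[of 1 0] row1[of 0 1] row2[of 1 0] row2[of 0 1] by simp
  then have det: "a * d - b * c \<noteq> 0" by auto
  have zero: "r i j = 0 \<and> s i j = 0" if "i + j > 1" for i j
  proof -
    have "(i, j) \<noteq> (0, 0)" "(i, j) \<noteq> (1, 0)" "(i, j) \<noteq> (0, 1)" using that by auto
    then have h: "a * r i j + b * s i j = 0" "c * r i j + d * s i j = 0"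
      using row1[of i j] row2[of i j] by auto
    have "(a * d - b * c) * r i j = d * (a * r i j + b * s i j) - b * (c * r i j + d * s i j)"
      "(a * d - b * c) * s i j = a * (c * r i j + d * s i j) - c * (a * r i j + b * s i j)"
      by algebra+
    then show ?thesis using h det by simp
  qed
  have "wle 1 1 1 (fst y)" "wle 1 1 1 (snd y)"
    using zero by (auto simp: wle_def r_def s_def not_le intro!: leI)
  then have "y \<in> affs" using inverses_is_aut(2)[OF y] by (simp add: affs_def)
  with y show ?thesis by blast
qed

text \<open>Words of \<open>aff_trg\<close> begin with a triangular factor and serve unequal
  degrees; those of \<open>trg_aff\<close> begin with an affine factor and serve equal
  degrees.\<close>

interpretation aff_trg: automorphism_groups "affs :: ('a::idom bpoly \<times> 'a bpoly) set" trgs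
  by unfold_locales (use affs_comp trgs_comp affs_inverse trgs_inverse bid_in in auto)

interpretation trg_aff: automorphism_groups "trgs :: ('a::idom bpoly \<times> 'a bpoly) set" affs
  by unfold_locales (use affs_comp trgs_comp affs_inverse trgs_inverse bid_in in auto)

section \<open>Generators of the tame group\<close>

lemma le_degx1: "coeff (coeff f j) i \<noteq> 0 \<Longrightarrow> i \<le> degx1 f"
proof -
  assume c: "coeff (coeff f j) i \<noteq> 0"
  then have "j \<le> degree f" by (intro le_degree) auto
  then have "degree (coeff f j) \<le> degx1 f"
    unfolding degx1_def by (intro Max_ge) auto
  moreover have "i \<le> degree (coeff f j)" using c by (rule le_degree)
  ultimately show ?thesis by linarith
qed

lemma le_degx2: "coeff (coeff f j) i \<noteq> 0 \<Longrightarrow> j \<le> degx2 f"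
  unfolding degx2_def by (intro le_degree) auto

lemma degx2_attained:
  assumes "degx2 f > 0"
  shows "\<exists>i. coeff (coeff f (degx2 f)) i \<noteq> 0"
proof -
  have "coeff f (degree f) \<noteq> 0" using assms by (auto simp: degx2_def)
  then show ?thesis unfolding degx2_def using leading_coeff_0_iff by blast
qed

lemma degx1_attained:
  assumes "degx1 f > 0"
  shows "\<exists>j. coeff (coeff f j) (degx1 f) \<noteq> 0"
proof -
  have "degx1 f \<in> (\<lambda>k. degree (coeff f k)) ` {..degree f}"
    unfolding degx1_def by (intro Max_in) auto
  then obtain j where "degx1 f = degree (coeff f j)" by auto
  with assms show ?thesis by (metis degree_0 leading_coeff_0_iff less_irrefl)
qed

lemma degx1_le: "(\<And>i j. coeff (coeff f j) i \<noteq> 0 \<Longrightarrow> i \<le> n) \<Longrightarrow> degx1 f \<le> n"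
  using degx1_attained[of f] by (cases "degx1 f = 0") auto

lemma degx2_le: "(\<And>i j. coeff (coeff f j) i \<noteq> 0 \<Longrightarrow> j \<le> n) \<Longrightarrow> degx2 f \<le> n"
  using degx2_attained[of f] by (cases "degx2 f = 0") auto

lemma finite_weights: "finite {p * i + q * j | i j. coeff (coeff f j) i \<noteq> 0}" for p q :: nat
proof (rule finite_subset)
  show "{p * i + q * j | i j. coeff (coeff f j) i \<noteq> 0}
      \<subseteq> (\<lambda>(i, j). p * i + q * j) ` ({..degx1 f} \<times> {..degx2 f})"
    by (force intro: le_degx1 le_degx2)
qed auto

lemma wle_wdeg: "wle p q (wdeg (p, q) f) f"
  using finite_weights[of p q f] by (auto simp: wle_def wdeg_def intro!: Max_ge)

lemma wdeg_le: "wle p q D f \<Longrightarrow> wdeg (p, q) f \<le> D"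
proof (cases "f = 0")
  case False
  assume w: "wle p q D f"
  from False obtain j where "coeff f j \<noteq> 0" by (metis leading_coeff_0_iff)
  then obtain i where "coeff (coeff f j) i \<noteq> 0" by (metis leading_coeff_0_iff)
  then have "{p * i + q * j | i j. coeff (coeff f j) i \<noteq> 0} \<noteq> {}" by blast
  then show ?thesis
    using w finite_weights[of p q f] False by (auto simp: wdeg_def wle_def)
qed (simp add: wdeg_def)

lemma constant_if_wle:
  assumes "wle 1 1 0 f"
  shows "\<exists>c. f = bconst c"
proof -
  have "coeff (coeff f j) i = 0" if "i + j > 0" for i j
    using wleD[OF assms, of j i] that by force
  then have "f = bconst (coeff (coeff f 0) 0)"
    by (auto simp: poly_eq_iff bconst_def coeff_pCons split: nat.splits)
  then show ?thesis ..
qed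

lemma bconst_neq_X: "bconst c \<noteq> X1" "bconst c \<noteq> X2"
  by (simp_all add: bconst_def X1_def X2_def)

text \<open>A constant component would make \<open>x1\<close> or \<open>x2\<close> constant, so both
  total degrees are exactly 1.\<close>

lemma affs_is_affine:
  assumes "x \<in> affs"
  shows "is_affine x"
proof -
  obtain y where y: "inverses x y" using assms by (auto simp: affs_def is_aut_def)
  have "\<nexists>c. fst x = bconst c" "\<nexists>c. snd x = bconst c"
    using y by (auto simp: bcomp_def bid_def bconst_neq_X)
  moreover have "wdeg (1, 1) f = 1" if "wle 1 1 1 f" "\<nexists>c. f = bconst c" for f :: "'a bpoly"
    using wdeg_le[OF that(1)] wle_wdeg[of 1 1 f] that(2) constant_if_wle[of f] by (cases "wdeg (1, 1) f") auto
  ultimately show ?thesis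
    using assms by (auto simp: is_affine_def affs_def totdeg_def)
qed

lemma is_affine_affs: "is_affine x \<Longrightarrow> x \<in> affs"
  by (auto simp: is_affine_def affs_def totdeg_def) (metis One_nat_def wle_wdeg)+

section \<open>Exchange of the two variables\<close>

definition swap :: "'a::comm_ring_1 bpoly \<times> 'a bpoly" where "swap = (X2, X1)"

lemma swap_swap: "bcomp swap swap = bid"
  by (simp add: bcomp_def swap_def bid_def)

lemma swap_affs: "swap \<in> affs"
proof -
  have "is_aut swap" using swap_swap by (intro inverses_is_aut(1)[of swap swap]) simp
  then show ?thesis
    by (auto simp: affs_def swap_def wle_def X1_def X2_def coeff_pCons split: nat.splits if_splits)
qed

lemma coeff_X1_mult: "coeff (coeff (X1 * g) j) i = (case i of 0 \<Rightarrow> 0 | Suc n \<Rightarrow> coeff (coeff g j) n)"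
  by (simp add: X1_def coeff_pCons)

lemma coeff_X2_mult: "coeff (X2 * g) j = (case j of 0 \<Rightarrow> 0 | Suc n \<Rightarrow> coeff g n)"
  by (simp add: X2_def coeff_pCons)

lemma coeff_esubst_X2: "coeff (coeff (esubst X2 c) j) i = (if i = 0 then coeff c j else 0)"
  by (induction c arbitrary: j)
    (auto simp: esubst_pCons coeff_X2_mult bconst_def coeff_pCons split: nat.splits)

lemma coeff_bsubst_swap: "coeff (coeff (bsubst f swap) j) i = coeff (coeff f i) j"
  by (induction f arbitrary: i)
    (auto simp: bsubst_pCons swap_def coeff_esubst_X2 coeff_X1_mult coeff_pCons split: nat.splits)

lemma degx_swap: "degx1 (bsubst f swap) = degx2 f" "degx2 (bsubst f swap) = degx1 f"
proof -
  show "degx1 (bsubst f swap) = degx2 f"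
  proof (rule antisym)
    show "degx1 (bsubst f swap) \<le> degx2 f"
      by (rule degx1_le) (auto simp: coeff_bsubst_swap intro: le_degx2)
    show "degx2 f \<le> degx1 (bsubst f swap)"
      by (rule degx2_le) (rule le_degx1, simp add: coeff_bsubst_swap)
  qed
  show "degx2 (bsubst f swap) = degx1 f"
  proof (rule antisym)
    show "degx2 (bsubst f swap) \<le> degx1 f"
      by (rule degx2_le) (auto simp: coeff_bsubst_swap intro: le_degx1)
    show "degx1 f \<le> degx2 (bsubst f swap)"
      by (rule degx1_le) (rule le_degx2, simp add: coeff_bsubst_swap)
  qed
qed

section \<open>Tame automorphisms as words\<close>

lemma affs_Tame: "affs \<subseteq> Tame"
  unfolding Tame_def by (auto intro!: gen_base affs_is_affine)

text \<open>A triangular map factors into two elementary ones, one changing only \<open>x1\<close>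
  and one only \<open>x2\<close>. The first factor is invertible because the inverse
  \<open>y\<close> is triangular too.\<close>

lemma trgs_Tame: "trgs \<subseteq> (Tame :: ('a::idom bpoly \<times> 'a bpoly) set)"
proof
  fix x :: "'a bpoly \<times> 'a bpoly"
  assume x: "x \<in> trgs"
  obtain y where y: "y \<in> trgs" "inverses x y" using trgs_inverse[OF x] by blast
  obtain p where p: "fst x = [:p:]" using x by (auto simp: trgs_def elim: degree_eq_zeroE)
  obtain q where q: "fst y = [:q:]" using y by (auto simp: trgs_def elim: degree_eq_zeroE)
  define d :: "'a bpoly \<times> 'a bpoly" where "d = (fst x, X2)"
  define d' :: "'a bpoly \<times> 'a bpoly" where "d' = (fst y, X2)"
  define e :: "'a bpoly \<times> 'a bpoly" where "e = (X1, snd x)"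
  have 1: "esubst [:p:] q = X1" "esubst [:q:] p = X1"
    using y(2) by (auto simp: bcomp_def bid_def p q bsubst_const)
  have "inverses d d'"
    using 1 by (simp add: d_def d'_def bcomp_def bid_def p q bsubst_const)
  then have d: "is_aut d" "is_aut d'" by (rule inverses_is_aut)+
  have "e = bcomp x d'"
    using 1 by (simp add: e_def d'_def bcomp_def p q bsubst_const)
  then have "is_aut e"
    using d(2) x is_aut_comp[of x d'] by (simp add: trgs_def)
  with d have "is_elementary d" "is_elementary e"
    by (simp_all add: is_elementary_def d_def e_def)
  moreover have "bcomp e d = x"
    by (simp add: e_def d_def bcomp_def p bsubst_const esubst_X1 prod_eq_iff)
  ultimately show "x \<in> Tame"
    unfolding Tame_def by (metis (mono_tags, lifting) gen_base gen_comp mem_Collect_eq)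
qed

text \<open>An elementary map fixing \<open>x2\<close> becomes triangular after conjugation by the
  swap.\<close>

lemma elementary_cases:
  fixes x :: "'a::idom bpoly \<times> 'a bpoly"
  assumes "is_elementary x"
  shows "x \<in> trgs \<or> (\<exists>y\<in>trgs. x = bcomp swap (bcomp y swap))"
proof (cases "fst x = X1")
  case True
  then show ?thesis using assms by (simp add: is_elementary_def trgs_def X1_def)
next
  case False
  define y where "y = bcomp swap (bcomp x swap)"
  have s: "is_aut swap" using swap_affs by (auto simp: affs_def)
  have "is_aut y"
    unfolding y_def by (rule is_aut_comp[OF s is_aut_comp[OF _ s]]) (use assms in \<open>simp add: is_elementary_def\<close>)
  moreover have "snd x = X2" using assms False by (simp add: is_elementary_def)
  then have "fst y = X1"
    by (simp add: y_def bcomp_def swap_def)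
  ultimately have "y \<in> trgs" by (simp add: trgs_def X1_def)
  moreover have "x = bcomp swap (bcomp y swap)"
    unfolding y_def by (metis bcomp_assoc bcomp_bid swap_swap)
  ultimately show ?thesis by blast
qed

lemma Tame_words:
  "Tame \<subseteq> (aff_trg.words :: ('a::idom bpoly \<times> 'a bpoly) set)"
  "Tame \<subseteq> (trg_aff.words :: ('a::idom bpoly \<times> 'a bpoly) set)"
proof -
  \<comment> \<open>\<open>G\<close> stands for the stabilizer of either kind of words.\<close>
  have gens: "{phi. is_affine phi \<or> is_elementary phi} \<subseteq> G"
    if G: "affs \<subseteq> G" "trgs \<subseteq> G" "\<And>x y. x \<in> G \<Longrightarrow> y \<in> G \<Longrightarrow> bcomp x y \<in> G"
    for G :: "('a bpoly \<times> 'a bpoly) set"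
  proof
    fix x :: "'a bpoly \<times> 'a bpoly"
    assume "x \<in> {phi. is_affine phi \<or> is_elementary phi}"
    then consider "x \<in> affs" | "x \<in> trgs" | y where "y \<in> trgs" "x = bcomp swap (bcomp y swap)"
      using is_affine_affs[of x] elementary_cases[of x] by blast
    then show "x \<in> G"
      using G swap_affs by cases blast+
  qed
  show "Tame \<subseteq> (aff_trg.words :: ('a bpoly \<times> 'a bpoly) set)"
    unfolding Tame_def
    by (rule aff_trg.gen_aut_words, rule gens)
      (fact aff_trg.subset_stabilizer aff_trg.stabilizer_comp)+
  show "Tame \<subseteq> (trg_aff.words :: ('a bpoly \<times> 'a bpoly) set)"
    unfolding Tame_def
    by (rule trg_aff.gen_aut_words, rule gens)
      (fact trg_aff.subset_stabilizer trg_aff.stabilizer_comp)+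
qed

section \<open>Automorphisms fixing a reduced polynomial\<close>

lemma trgs_form:
  fixes x :: "'a::idom bpoly \<times> 'a bpoly"
  assumes "x \<in> trgs"
  obtains v u p w where "fst x = [:[:v, u:]:]" "snd x = [:p, [:w:]:]"
proof -
  obtain y where "inverses x y" using assms by (auto simp: trgs_def is_aut_def)
  then have "bcomp y x = bid" "degree (fst x) = 0" using assms by (auto simp: trgs_def)
  then show ?thesis by (rule trgs_structure) (rule that)
qed

lemma apex1_trg:
  fixes f :: "'a::idom bpoly"
  assumes "x \<in> trgs - affs" "apex2 D f"
  shows "\<exists>k\<ge>2. apex1 (k * D) (bsubst f x)"
proof -
  obtain v u p w where x: "fst x = [:[:v, u:]:]" "snd x = [:p, [:w:]:]"
    using assms(1) by (auto elim: trgs_form)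
  have f: "wle 1 1 D f" "coeff (coeff f D) 0 \<noteq> 0" using assms(2) by (auto simp: apex2_def)
  have k: "degree p \<ge> 2"
  proof (rule ccontr)
    assume "\<not> degree p \<ge> 2"
    then have "i \<le> 1" if "coeff p i \<noteq> 0" for i using le_degree[OF that] by linarith
    then have "wle 1 1 1 (snd x)"
      by (auto simp: wle_def x coeff_pCons split: nat.splits)
    moreover have "wle 1 1 1 (fst x)"
      by (auto simp: wle_def x coeff_pCons split: nat.splits)
    ultimately show False using assms(1) by (auto simp: affs_def trgs_def)
  qed
  \<comment> \<open>Multiplying \<open>i + j \<le> D\<close> by \<open>degree p \<ge> 2\<close>
    leaves a surplus of at least \<open>i\<close>, so equality forces \<open>i = 0\<close>.\<close>
  have *: "i + degree p * j \<le> degree p * D \<and> (i + degree p * j = degree p * D \<longrightarrow> i = 0)"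
    if c: "coeff (coeff f j) i \<noteq> 0" for i j
  proof -
    have "degree p * (i + j) \<le> degree p * D"
      using wleD[OF f(1) c] by simp
    moreover have "2 * i \<le> degree p * i" using k by (rule mult_right_mono) simp
    ultimately show ?thesis unfolding distrib_left by linarith
  qed
  have "apex1 (degree p * D) (bsubst f x)"
    by (rule apex1_triangular[OF x k refl]) (use * f in \<open>auto simp: wle_def\<close>)
  then show ?thesis using k by blast
qed

lemma wle_wdeg_weight:
  assumes "wdeg (weight f) f = degx1 f * degx2 f"
  shows "wle (degx2 f) (degx1 f) (degx1 f * degx2 f) f"
  using wle_wdeg[of "degx2 f" "degx1 f" f] assms by (simp add: weight_def)

lemma equal_degrees_affine:
  fixes f :: "'a::idom bpoly"
  assumes d: "d > 0" and f: "wle 1 1 d f"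
    and reduced: "\<And>t. t \<in> Tame \<Longrightarrow> d + d \<le> degx1 (bsubst f t) + degx2 (bsubst f t)"
    and x: "x \<in> Tame" "bsubst f x = f"
  shows "x \<in> affs"
proof -
  \<comment> \<open>An affine map keeps both degrees at most \<open>d\<close>, so reducedness makes
    them equal to \<open>d\<close>; within total degree \<open>d\<close>, only the pure power
    \<open>x2^d\<close> has \<open>x2\<close>-degree \<open>d\<close>.\<close>
  have start: "apex2 d (bsubst f m)" if "m \<in> affs" for m
  proof -
    have w: "wle 1 1 d (bsubst f m)"
      using that by (intro wle_bsubst[OF f]) (auto simp: affs_def)
    have "degx1 (bsubst f m) \<le> d" "degx2 (bsubst f m) \<le> d"
      using wleD[OF w] by (force intro: degx1_le degx2_le)+
    then have "degx2 (bsubst f m) = d"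
      using reduced[of m] that affs_Tame by fastforce
    then obtain i where i: "coeff (coeff (bsubst f m) d) i \<noteq> 0"
      using degx2_attained[of "bsubst f m"] d by auto
    then have "i = 0" using wleD[OF w i] by simp
    with i w show ?thesis by (simp add: apex2_def)
  qed
  have "(trg_aff.words_A m \<longrightarrow> (\<exists>D>d. apex1 D (bsubst f m)))
      \<and> (trg_aff.words_B m \<longrightarrow> (\<exists>D>d. apex2 D (bsubst f m)))" for m
  proof -
    \<comment> \<open>The factor \<open>k \<ge> 2\<close> gives the strict inequality that separates
      the result from \<open>f\<close>, whose total degree is at most \<open>d\<close>.\<close>
    have big: "\<exists>D>d. apex1 D (bsubst f (bcomp b m))"
      if b: "b \<in> trgs - affs" and D: "apex2 D (bsubst f m)" "D \<ge> d" for b m D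
    proof -
      from apex1_trg[OF b D(1)] obtain k where k: "k \<ge> 2" "apex1 (k * D) (bsubst f (bcomp b m))"
        by (auto simp: bsubst_bcomp)
      have "2 * D \<le> k * D" using k(1) by simp
      then have "k * D > d" using D(2) d by linarith
      with k(2) show ?thesis by blast
    qed
    show ?thesis
    proof (rule trg_aff.words_A_words_B.induct)
      show "\<exists>D>d. apex1 D (bsubst f (bcomp b m))" if "b \<in> trgs - affs" "m \<in> affs" for b m
        using big[OF that(1) start[OF that(2)]] by simp
      show "\<exists>D>d. apex1 D (bsubst f (bcomp b m))"
        if "b \<in> trgs - affs" "\<exists>D>d. apex2 D (bsubst f m)" for b m
        using big[OF that(1)] that(2) by (meson less_imp_le)
      show "\<exists>D>d. apex2 D (bsubst f (bcomp a m))"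
        if "a \<in> affs - trgs" "\<exists>D>d. apex1 D (bsubst f m)" for a m
        using apex2_affine[OF that(1)] that(2) by (metis bsubst_bcomp)
    qed
  qed
  moreover have "\<not> apex1 D f" "\<not> apex2 D f" if "D > d" for D
    using wleD[OF f] that by (fastforce simp: apex1_def apex2_def)+
  ultimately have "\<not> trg_aff.words_A x" "\<not> trg_aff.words_B x"
    using x(2) by metis+
  then show ?thesis
    using x(1) Tame_words(2) by (auto simp: trg_aff.words_def)
qed

text \<open>The degree of \<open>p\<close> is compared with the slope of the Newton triangle with
  vertices \<open>(0, 0)\<close>, \<open>(a, 0)\<close>, \<open>(0, b)\<close>. If
  \<open>b * degree p \<le> a\<close>, the triangle is preserved and reducedness retains the vertex
  \<open>(a, 0)\<close>. Otherwise \<open>p\<close> dominates and the vertex \<open>(0, b)\<close>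
  alone determines the top form.\<close>

lemma apex1_reduced_triangular:
  fixes f :: "'a::idom bpoly"
  assumes ab: "a > b" "b > 0" and f: "wle b a (a * b) f" "degx2 f = b"
    and reduced: "a + b \<le> degx1 (bsubst f m) + degx2 (bsubst f m)"
    and m: "m \<in> trgs"
  shows "\<exists>D\<ge>a. apex1 D (bsubst f m)"
proof -
  obtain v u p w where x: "fst m = [:[:v, u:]:]" "snd m = [:p, [:w:]:]"
    using m by (auto elim: trgs_form)
  show ?thesis
  proof (cases "b * degree p \<le> a")
    case True
    have "b * i \<le> a" if "coeff p i \<noteq> 0" for i
      using le_degree[OF that] True by (meson le_trans mult_le_mono2)
    then have "wle b a a (snd m)"
      by (auto simp: wle_def x coeff_pCons split: nat.splits)
    moreover have "wle b a b (fst m)"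
      by (auto simp: wle_def x coeff_pCons split: nat.splits)
    ultimately have W: "wle b a (a * b) (bsubst f m)"
      by (intro wle_bsubst[OF f(1)])
    define g where "g = bsubst f m"
    have g: "b * i + a * j \<le> a * b" if "coeff (coeff g j) i \<noteq> 0" for i j
      using wleD[OF W] that by (simp add: g_def)
    have le_a: "i \<le> a" if "coeff (coeff g j) i \<noteq> 0" for i j
    proof -
      have "b * i \<le> b * a" using g[OF that] unfolding mult.commute[of b a] by linarith
      then show ?thesis using ab by simp
    qed
    have "degx1 g \<le> a" by (intro degx1_le le_a)
    moreover have "degx2 g \<le> b"
    proof (rule degx2_le)
      fix i j assume "coeff (coeff g j) i \<noteq> 0"
      from g[OF this] have "a * j \<le> a * b" by linarith
      then show "j \<le> b" using ab by simp
    qed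
    ultimately have "degx1 g = a" using reduced by (simp add: g_def)
    then obtain j where j: "coeff (coeff g j) a \<noteq> 0"
      using degx1_attained[of g] ab by auto
    \<comment> \<open>The column \<open>i = a\<close> of the triangle contains only the
      vertex.\<close>
    have "j = 0" using g[OF j] ab by (simp add: mult.commute)
    with j have "coeff (coeff g 0) a \<noteq> 0" by simp
    \<comment> \<open>Since \<open>b < a\<close>, the triangle meets the line of total degree
      \<open>a\<close> only at \<open>(a, 0)\<close>.\<close>
    moreover have "i + j \<le> a \<and> (i + j = a \<longrightarrow> j = 0)" if c: "coeff (coeff g j) i \<noteq> 0" for i j
    proof -
      have "(b + 1) * j \<le> a * j" using ab by (intro mult_right_mono) auto
      then have 1: "b * (i + j) + j \<le> b * a"
        using g[OF c] by (simp add: algebra_simps)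
      then have "b * (i + j) \<le> b * a" by linarith
      then have "i + j \<le> a" using ab by (simp only: mult_le_cancel1)
      moreover have "i + j = a \<longrightarrow> j = 0" using 1 by auto
      ultimately show ?thesis ..
    qed
    ultimately have "apex1 a g" by (auto simp: apex1_def wle_def)
    then show ?thesis by (auto simp: g_def)
  next
    case False
    define k where "k = degree p"
    have kb: "k * b > a" using False by (simp add: k_def mult.commute)
    have "k \<ge> 2"
    proof (rule ccontr)
      assume "\<not> k \<ge> 2"
      then have "k * b \<le> 1 * b" by (intro mult_right_mono) auto
      then show False using kb ab by linarith
    qed
    obtain i where i: "coeff (coeff f b) i \<noteq> 0"
      using degx2_attained[of f] ab f(2) by auto
    have "i = 0" using wleD[OF f(1) i] ab by simp
    with i have top: "coeff (coeff f b) 0 \<noteq> 0" by simp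
    \<comment> \<open>With \<open>t = b - j\<close> the triangle gives
      \<open>b * i \<le> a * t\<close>; as \<open>a < k * b\<close>, this yields
      \<open>i \<le> k * t\<close>, strictly unless \<open>t = 0\<close>.\<close>
    have *: "i + k * j \<le> k * b \<and> (i + k * j = k * b \<longrightarrow> i = 0)"
      if c: "coeff (coeff f j) i \<noteq> 0" for i j
    proof -
      have "j \<le> b" using le_degx2[OF c] f(2) by simp
      then obtain t where t: "b = j + t" by (metis le_iff_add)
      have "b * i \<le> a * t" using wleD[OF f(1) c] by (simp add: t algebra_simps)
      moreover have "a * t \<le> (k * b) * t" using kb by (intro mult_right_mono) auto
      moreover have "(k * b) * t = b * (k * t)" by (simp add: ac_simps)
      ultimately have "b * i \<le> b * (k * t)" by linarith
      then have 1: "i \<le> k * t" using ab by (simp only: mult_le_cancel1)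
      have "t = 0" if "i = k * t"
      proof (rule ccontr)
        assume "t \<noteq> 0"
        then have "a * t < (k * b) * t" using kb by simp
        then show False using \<open>b * i \<le> a * t\<close> that by (simp add: algebra_simps)
      qed
      then show ?thesis using 1 by (auto simp: t algebra_simps)
    qed
    have "apex1 (k * b) (bsubst f m)"
      by (rule apex1_triangular[OF x, folded k_def, OF \<open>k \<ge> 2\<close> refl])
        (use * top in \<open>auto simp: wle_def\<close>)
    then show ?thesis using kb by (meson less_imp_le)
  qed
qed

lemma greater_degree_triangular:
  fixes f :: "'a::idom bpoly"
  assumes ab: "degx1 f > degx2 f" "degx2 f > 0" and f: "wle (degx2 f) (degx1 f) (degx1 f * degx2 f) f"
    and reduced: "\<And>t. t \<in> Tame \<Longrightarrow> degx1 f + degx2 f \<le> degx1 (bsubst f t) + degx2 (bsubst f t)"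
    and x: "x \<in> Tame" "bsubst f x = f"
  shows "x \<in> trgs"
proof -
  let ?a = "degx1 f"
  have start: "\<exists>D\<ge>?a. apex1 D (bsubst f m)" if "m \<in> trgs" for m
    using apex1_reduced_triangular[OF ab f refl reduced that] that trgs_Tame by blast
  \<comment> \<open>Triangular letters make the bound strict, as they must: \<open>f\<close> itself
    may satisfy \<open>apex1\<close> with \<open>D = ?a\<close>. For \<open>apex2\<close> the weak
    bound already exceeds the \<open>x2\<close>-degree of \<open>f\<close>.\<close>
  have "(aff_trg.words_A m \<longrightarrow> (\<exists>D\<ge>?a. apex2 D (bsubst f m)))
      \<and> (aff_trg.words_B m \<longrightarrow> (\<exists>D>?a. apex1 D (bsubst f m)))" for m
  proof (rule aff_trg.words_A_words_B.induct)
    show "\<exists>D\<ge>?a. apex2 D (bsubst f (bcomp c m))" if "c \<in> affs - trgs" "m \<in> trgs" for c m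
      using start[OF that(2)] apex2_affine[OF that(1)] by (metis bsubst_bcomp)
    show "\<exists>D\<ge>?a. apex2 D (bsubst f (bcomp c m))"
      if "c \<in> affs - trgs" "\<exists>D>?a. apex1 D (bsubst f m)" for c m
      using that(2) apex2_affine[OF that(1)] by (metis bsubst_bcomp less_imp_le)
    show "\<exists>D>?a. apex1 D (bsubst f (bcomp c m))"
      if c: "c \<in> trgs - affs" "\<exists>D\<ge>?a. apex2 D (bsubst f m)" for c m
    proof -
      from c(2) obtain D where D: "D \<ge> ?a" "apex2 D (bsubst f m)" by blast
      from apex1_trg[OF c(1) D(2)] obtain k where k: "k \<ge> 2" "apex1 (k * D) (bsubst f (bcomp c m))"
        by (auto simp: bsubst_bcomp)
      have "2 * D \<le> k * D" using k(1) by simp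
      then have "k * D > ?a" using D(1) ab by linarith
      with k(2) show ?thesis by blast
    qed
  qed
  moreover have "\<not> apex2 D f" if "D \<ge> ?a" for D
    using that le_degx2[of f D 0] ab by (auto simp: apex2_def)
  moreover have "\<not> apex1 D f" if "D > ?a" for D
    using that le_degx1[of f 0 D] by (auto simp: apex1_def)
  ultimately have "\<not> aff_trg.words_A x" "\<not> aff_trg.words_B x"
    using x(2) by metis+
  then show ?thesis
    using x(1) Tame_words(1) by (auto simp: aff_trg.words_def)
qed

section \<open>From the stabilizing automorphisms to \<open>H(f)\<close>, \<open>Aff\<close> and
  \<open>J\<close>\<close>

lemma Hset_fixes: "x \<in> Hset f \<Longrightarrow> x \<in> Tame \<and> is_aut x \<and> bsubst f x = f"
proof -
  assume x: "x \<in> Hset f"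
  have "f = poly (map_poly bconst [:0, 1:]) f"
    by (simp add: map_poly_bconst_pCons map_poly_1)
  then have "f \<in> Rsub f" unfolding Rsub_def by blast
  with x show ?thesis by (auto simp: Hset_def)
qed

lemma trgs_Jset: "trgs \<subseteq> Jset 1"
proof
  fix x :: "'a bpoly \<times> 'a bpoly" assume x: "x \<in> trgs"
  have "bsubst g x \<in> Rx 1" if "g \<in> Rx 1" for g
  proof -
    have "degree g = 0" using that by (simp add: Rx_def)
    then obtain c where "g = [:c:]" by (rule degree_eq_zeroE)
    moreover obtain p where "fst x = [:p:]" using x by (auto simp: trgs_def elim: degree_eq_zeroE)
    ultimately show ?thesis by (simp add: Rx_def bsubst_const esubst_const)
  qed
  with x show "x \<in> Jset 1" by (auto simp: Jset_def trgs_def)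
qed

lemma Rx_2_iff: "f \<in> Rx 2 \<longleftrightarrow> wle 1 0 0 f"
proof -
  have "degree c = 0 \<longleftrightarrow> (\<forall>i. coeff c i \<noteq> 0 \<longrightarrow> i = 0)" for c :: "'a poly"
    by (metis le_degree le_zero_eq leading_coeff_0_iff degree_0)
  then show ?thesis by (auto simp: Rx_def wle_def)
qed

text \<open>Triangularity of the conjugate by the swap says that \<open>x1\<close> does not occur in
  \<open>snd x\<close>.\<close>

lemma swapped_trgs_Jset:
  assumes "is_aut x" "bcomp swap (bcomp x swap) \<in> trgs"
  shows "x \<in> Jset 2"
proof -
  have "degree (bsubst (snd x) swap) = 0"
    using assms(2) by (simp add: trgs_def bcomp_def) (simp add: swap_def)
  then have "degx1 (snd x) = 0" using degx_swap(2)[of "snd x"] by (simp add: degx2_def)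
  then have s: "wle 1 0 0 (snd x)" using le_degx1[of "snd x"] by (fastforce simp: wle_def)
  have F: "wle 1 0 (degx1 (fst x)) (fst x)" by (auto simp: wle_def intro: le_degx1)
  have "wle 1 0 0 (bsubst g x)" if "wle 1 0 0 g" for g
    by (rule wle_bsubst[OF _ F s]) (use that in \<open>auto simp: wle_def\<close>)
  then show ?thesis using assms(1) by (simp add: Jset_def Rx_2_iff)
qed

theorem theorem2p2p4:
  fixes f :: "'a::idom bpoly"
  assumes "degx1 f > 0" and "degx2 f > 0"
    and "wdeg (weight f) f = degx1 f * degx2 f"
    and "tamely_reduced f"
  shows "(degx1 f = degx2 f \<longrightarrow> Hset f \<subseteq> Aff)
    \<and> (\<forall>i j. i \<in> {1, 2} \<and> j \<in> {1, 2} \<and> i \<noteq> j \<and> degx i f > degx j f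
          \<longrightarrow> Hset f \<subseteq> Jset i)"
proof -
  have reduced: "degx1 f + degx2 f \<le> degx1 (bsubst f t) + degx2 (bsubst f t)" if "t \<in> Tame" for t
    using assms(4) that by (simp add: tamely_reduced_def)
  have W: "wle (degx2 f) (degx1 f) (degx1 f * degx2 f) f"
    by (rule wle_wdeg_weight) fact
  have "Hset f \<subseteq> Aff" if eq: "degx1 f = degx2 f"
  proof
    fix x assume "x \<in> Hset f"
    then have x: "x \<in> Tame" "bsubst f x = f" using Hset_fixes by blast+
    \<comment> \<open>Both weights equal the common degree, which cancels.\<close>
    have "i + j \<le> degx1 f" if "coeff (coeff f j) i \<noteq> 0" for i j
    proof -
      have "degx1 f * (i + j) \<le> degx1 f * degx1 f"
        using wleD[OF W that] eq by (simp add: algebra_simps)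
      then show ?thesis using assms(1) by simp
    qed
    then have "wle 1 1 (degx1 f) f" by (simp add: wle_def)
    then have "x \<in> affs"
      using reduced eq by (intro equal_degrees_affine[OF assms(1) _ _ x]) auto
    then show "x \<in> Aff" unfolding Aff_def by (auto intro: gen_base affs_is_affine)
  qed
  moreover have "Hset f \<subseteq> Jset 1" if "degx1 f > degx2 f"
    using greater_degree_triangular[OF that assms(2) W reduced] Hset_fixes trgs_Jset by blast
  moreover have "Hset f \<subseteq> Jset 2" if gt: "degx2 f > degx1 f"
  proof
    fix x assume "x \<in> Hset f"
    then have x: "x \<in> Tame" "bsubst f x = f" "is_aut x" using Hset_fixes by blast+
    \<comment> \<open>Conjugation by the swap reduces this case to the previous one, with
      \<open>g\<close> and \<open>y\<close> in place of \<open>f\<close> and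
      \<open>x\<close>.\<close>
    define g where "g = bsubst f swap"
    define y where "y = bcomp swap (bcomp x swap)"
    have swap: "swap \<in> Tame" using swap_affs affs_Tame by blast
    have comp: "bcomp s t \<in> Tame" if "s \<in> Tame" "t \<in> Tame" for s t :: "'a bpoly \<times> 'a bpoly"
      using that unfolding Tame_def by (rule gen_comp)
    have degs: "degx1 g = degx2 f" "degx2 g = degx1 f" by (simp_all add: g_def degx_swap)
    have "y \<in> trgs"
    proof (rule greater_degree_triangular)
      show "wle (degx2 g) (degx1 g) (degx1 g * degx2 g) g"
        unfolding degs wle_def
      proof (intro allI impI)
        fix i j assume "coeff (coeff g j) i \<noteq> 0"
        then have "coeff (coeff f i) j \<noteq> 0" by (simp add: g_def coeff_bsubst_swap)
        from wleD[OF W this] show "degx1 f * i + degx2 f * j \<le> degx2 f * degx1 f"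
          by (simp add: mult.commute add.commute)
      qed
      \<comment> \<open>Composing \<open>t\<close> with the swap is again tame, so minimality passes
        from \<open>f\<close> to \<open>g\<close>.\<close>
      show "degx1 g + degx2 g \<le> degx1 (bsubst g t) + degx2 (bsubst g t)" if "t \<in> Tame" for t
        using reduced[OF comp[OF that swap]] unfolding degs by (simp add: g_def bsubst_bcomp)
      show "y \<in> Tame" unfolding y_def by (intro comp swap x)
      have "bsubst g swap = f"
        using bsubst_bcomp[of f swap swap] by (simp add: g_def swap_swap)
      then show "bsubst g y = g"
        by (simp add: y_def bsubst_bcomp x) (simp add: g_def)
    qed (use gt assms degs in simp_all)
    then show "x \<in> Jset 2" using x(3) swapped_trgs_Jset by (simp add: y_def)
  qed
  ultimately show ?thesis by (auto simp: degx_def)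
qed

end
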